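(* Let $w=(w_n)_{n\in\mathbb{Z}}$ be a sequence of non-zero scalars such that the bilateral weighted backward shift $B_w(x_n)_{n\in\mathbb{Z}}=(w_{n+1}x_{n+1})_{n\in\mathbb{Z}}$ is an invertible operator on $c_0(\mathbb{Z})$. If $B_w$ is upper frequently hypercyclic on $c_0(\mathbb{Z})$, then $B_w^{-1}$ is upper frequently hypercyclic on $c_0(\mathbb{Z})$.
   Context: Scalars are real or complex; $c_0(\mathbb{Z})$ is the Banach space of scalar sequences $(x_n)_{n\in\mathbb{Z}}$ with $x_n\to0$ as $|n|\to\infty$, with the sup norm. An operator on a Banach space is a continuous linear self-map; it is invertible if it is bijective with continuous inverse. An operator $T$ on a Banach space $X$ is upper frequently hypercyclic if there is a vector $x\in X$ such that, for every non-empty open subset $U$ of $X$, the set $\{n\geq 0: T^nx\in U\}$ has positive upper density, that is, $\limsup_{N\to\infty}\frac{1}{N+1}\operatorname{card}\{n\leq N: T^nx\in U\}>0$. *)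

theory Defs
  imports "HOL-Analysis.Analysis"
begin

typedef (overloaded) 'a c0 =
  "{x :: int \<Rightarrow> 'a::real_normed_vector. (x \<longlongrightarrow> 0) (filtercomap abs at_top)}"
  morphisms c0_nth Abs_c0
  by (intro exI[of _ "\<lambda>_. 0"]) auto

setup_lifting type_definition_c0

lemma c0_eqI: "(\<And>n. c0_nth x n = c0_nth y n) \<Longrightarrow> x = y"
  by (auto intro: c0_nth_inject[THEN iffD1])

lemma c0_nth_tendsto: "(c0_nth x \<longlongrightarrow> 0) (filtercomap abs at_top)"
  using c0_nth[of x] by simp

lemma bdd_above_c0:
  fixes x :: "int \<Rightarrow> 'a::real_normed_vector"
  assumes "(x \<longlongrightarrow> 0) (filtercomap abs at_top)"
  shows "bdd_above (range (\<lambda>n. norm (x n)))"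
proof -
  have "\<forall>\<^sub>F n in filtercomap abs at_top. norm (x n) < 1"
    using tendsto_norm_zero[OF assms] order_tendstoD(2) zero_less_one by blast
  then obtain N where N: "\<And>n. \<bar>n\<bar> \<ge> N \<Longrightarrow> norm (x n) < 1"
    unfolding eventually_filtercomap_at_top_linorder by blast
  have "bdd_above ((\<lambda>n. norm (x n)) ` {-N..N} \<union> {..1})"
    by simp
  moreover have "norm (x n) \<in> (\<lambda>n. norm (x n)) ` {-N..N} \<union> {..1}" for n
  proof (cases "\<bar>n\<bar> \<ge> N")
    case True
    then show ?thesis using N[of n] by simp
  next
    case False
    then have "n \<in> {-N..N}" by auto
    then show ?thesis by blast
  qed
  ultimately show ?thesis
    by (meson bdd_above_mono image_subsetI)
qed

instantiation c0 :: (real_normed_vector) real_vector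
begin

lift_definition zero_c0 :: "'a c0" is "\<lambda>_. 0" by simp
lift_definition plus_c0 :: "'a c0 \<Rightarrow> 'a c0 \<Rightarrow> 'a c0" is "\<lambda>x y n. x n + y n"
  by (rule tendsto_add_zero)
lift_definition uminus_c0 :: "'a c0 \<Rightarrow> 'a c0" is "\<lambda>x n. - x n"
  using tendsto_minus by fastforce
lift_definition minus_c0 :: "'a c0 \<Rightarrow> 'a c0 \<Rightarrow> 'a c0" is "\<lambda>x y n. x n - y n"
  using tendsto_diff by fastforce
lift_definition scaleR_c0 :: "real \<Rightarrow> 'a c0 \<Rightarrow> 'a c0" is "\<lambda>r x n. r *\<^sub>R x n"
  using tendsto_scaleR[OF tendsto_const] by fastforce

instance
proof
  fix x y z :: "'a c0" and a b :: real
  show "x + y + z = x + (y + z)" "x + y = y + x" "0 + x = x" "- x + x = 0" "x - y = x + - y"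
    "a *\<^sub>R (x + y) = a *\<^sub>R x + a *\<^sub>R y" "(a + b) *\<^sub>R x = a *\<^sub>R x + b *\<^sub>R x"
    "a *\<^sub>R b *\<^sub>R x = (a * b) *\<^sub>R x" "1 *\<^sub>R x = x"
    by (transfer; simp add: algebra_simps)+
qed

end

instantiation c0 :: (real_normed_vector) real_normed_vector
begin

definition norm_c0 :: "'a c0 \<Rightarrow> real" where
  "norm_c0 x = (SUP n. norm (c0_nth x n))"
definition dist_c0 :: "'a c0 \<Rightarrow> 'a c0 \<Rightarrow> real" where
  "dist_c0 x y = norm (x - y)"
definition sgn_c0 :: "'a c0 \<Rightarrow> 'a c0" where
  "sgn_c0 x = x /\<^sub>R norm x"
definition uniformity_c0 :: "('a c0 \<times> 'a c0) filter" where
  "uniformity_c0 = (INF e\<in>{0<..}. principal {(x, y). dist x y < e})"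
definition open_c0 :: "'a c0 set \<Rightarrow> bool" where
  "open_c0 U \<longleftrightarrow> (\<forall>x\<in>U. \<forall>\<^sub>F (x', y) in uniformity. x' = x \<longrightarrow> y \<in> U)"

instance
proof
  fix x y :: "'a c0" and a :: real
  have le: "norm (c0_nth u n) \<le> norm u" for u :: "'a c0" and n
    unfolding norm_c0_def by (intro cSUP_upper bdd_above_c0 c0_nth_tendsto) simp
  show "dist x y = norm (x - y)" by (rule dist_c0_def)
  show "sgn x = x /\<^sub>R norm x" by (rule sgn_c0_def)
  show "uniformity = (INF e\<in>{0<..}. principal {(x::'a c0, y). dist x y < e})"
    by (rule uniformity_c0_def)
  show "open U \<longleftrightarrow> (\<forall>x\<in>U. \<forall>\<^sub>F (x', y) in uniformity. x' = x \<longrightarrow> y \<in> U)" for U :: "'a c0 set"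
    by (rule open_c0_def)
  show "norm x = 0 \<longleftrightarrow> x = 0"
  proof
    assume "norm x = 0"
    then have "c0_nth x n = 0" for n using le[of x n] by simp
    then show "x = 0" by (intro c0_eqI) (simp add: zero_c0.rep_eq)
  qed (simp add: norm_c0_def zero_c0.rep_eq)
  show "norm (x + y) \<le> norm x + norm y"
    unfolding norm_c0_def[of "x + y"]
    by (intro cSUP_least) (auto simp: plus_c0.rep_eq intro!: norm_triangle_le add_mono le)
  show "norm (a *\<^sub>R x) = \<bar>a\<bar> * norm x"
  proof (cases "a = 0")
    case True
    then show ?thesis by (simp add: norm_c0_def scaleR_c0.rep_eq zero_c0.rep_eq)
  next
    case False
    have sub: "norm (b *\<^sub>R u) \<le> \<bar>b\<bar> * norm u" for b and u :: "'a c0"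
      unfolding norm_c0_def[of "b *\<^sub>R u"]
      by (intro cSUP_least) (auto simp: scaleR_c0.rep_eq intro!: mult_left_mono le)
    have "inverse a *\<^sub>R a *\<^sub>R x = x"
      using False by transfer simp
    then have "norm x \<le> \<bar>inverse a\<bar> * norm (a *\<^sub>R x)"
      using sub[of "inverse a" "a *\<^sub>R x"] by simp
    then have "\<bar>a\<bar> * norm x \<le> norm (a *\<^sub>R x)"
      using False by (simp add: field_simps)
    then show ?thesis using sub[of a x] by simp
  qed
qed

end

lemma norm_c0_nth_le: "norm (c0_nth x n) \<le> norm x"
  unfolding norm_c0_def by (intro cSUP_upper bdd_above_c0 c0_nth_tendsto) simp

lemma norm_c0_le: "(\<And>n. norm (c0_nth x n) \<le> B) \<Longrightarrow> norm x \<le> B"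
  unfolding norm_c0_def by (intro cSUP_least) auto

instance c0 :: (banach) banach
proof
  fix X :: "nat \<Rightarrow> 'a c0"
  assume X: "Cauchy X"
  define f where "f n = lim (\<lambda>k. c0_nth (X k) n)" for n
  have near: "norm (c0_nth (X k) n - c0_nth (X m) n) \<le> norm (X k - X m)" for k m n
    using norm_c0_nth_le[of "X k - X m" n] by (simp add: minus_c0.rep_eq)
  have "Cauchy (\<lambda>k. c0_nth (X k) n)" for n
    using X near unfolding Cauchy_iff by (meson le_less_trans)
  then have f: "(\<lambda>k. c0_nth (X k) n) \<longlonglongrightarrow> f n" for n
    unfolding f_def using Cauchy_convergent_iff convergent_LIMSEQ_iff by blast
  have unif: "\<exists>M. \<forall>k\<ge>M. \<forall>n. norm (c0_nth (X k) n - f n) \<le> e" if "e > 0" for e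
  proof -
    obtain M where M: "\<And>k m. k \<ge> M \<Longrightarrow> m \<ge> M \<Longrightarrow> norm (X k - X m) < e"
      using X \<open>e > 0\<close> unfolding Cauchy_iff by metis
    have "norm (c0_nth (X k) n - f n) \<le> e" if "k \<ge> M" for k n
    proof (rule Lim_bounded)
      show "(\<lambda>m. norm (c0_nth (X k) n - c0_nth (X m) n)) \<longlonglongrightarrow> norm (c0_nth (X k) n - f n)"
        by (intro tendsto_intros f)
      show "\<forall>m\<ge>M. norm (c0_nth (X k) n - c0_nth (X m) n) \<le> e"
        using near M[OF that] by (meson le_less_trans less_imp_le)
    qed
    then show ?thesis by blast
  qed
  have "(f \<longlongrightarrow> 0) (filtercomap abs at_top)"
  proof (rule tendstoI)
    fix e :: real assume "e > 0"
    then obtain M where M: "\<And>n. norm (c0_nth (X M) n - f n) \<le> e / 2"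
      using unif[of "e / 2"] by auto
    have "\<forall>\<^sub>F n in filtercomap abs at_top. dist (c0_nth (X M) n) 0 < e / 2"
      using c0_nth_tendsto \<open>e > 0\<close> by (intro tendstoD) auto
    then show "\<forall>\<^sub>F n in filtercomap abs at_top. dist (f n) 0 < e"
    proof eventually_elim
      case (elim n)
      have "norm (f n) \<le> norm (c0_nth (X M) n) + norm (c0_nth (X M) n - f n)"
        by (metis norm_minus_commute norm_triangle_sub)
      then show ?case using elim M[of n] by simp
    qed
  qed
  then have nth: "c0_nth (Abs_c0 f) = f" by (simp add: Abs_c0_inverse)
  have "X \<longlonglongrightarrow> Abs_c0 f"
  proof (rule metric_LIMSEQ_I)
    fix e :: real assume "e > 0"
    then obtain M where M: "\<And>k n. k \<ge> M \<Longrightarrow> norm (c0_nth (X k) n - f n) \<le> e / 2"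
      using unif[of "e / 2"] by auto
    have "norm (X k - Abs_c0 f) \<le> e / 2" if "k \<ge> M" for k
      using M[OF that] by (intro norm_c0_le) (simp only: minus_c0.rep_eq nth)
    then show "\<exists>M. \<forall>k\<ge>M. dist (X k) (Abs_c0 f) < e"
      using \<open>e > 0\<close> by (intro exI[of _ M]) (fastforce simp: dist_norm)
  qed
  then show "convergent X" by (rule convergentI)
qed

text \<open>
  Multiplication by scalars of the ground field; over \<^typ>\<open>complex\<close> it extends the
  real scaling provided by the class. A field in both \<^class>\<open>real_normed_field\<close> and
  \<^class>\<open>euclidean_space\<close> is isometrically isomorphic to \<^typ>\<open>real\<close> or \<^typ>\<open>complex\<close>,
  and these two types are instances.
\<close>

lift_definition c0_scale :: "'a::real_normed_field \<Rightarrow> 'a c0 \<Rightarrow> 'a c0" is "\<lambda>a x n. a * x n"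
  by (rule tendsto_mult_right_zero)

lemma vector_space_c0_scale: "vector_space (c0_scale :: 'a::real_normed_field \<Rightarrow> _)"
  by unfold_locales (transfer; simp add: algebra_simps)+

definition c0_operator :: "('a::real_normed_field c0 \<Rightarrow> 'a c0) \<Rightarrow> bool" where
  "c0_operator T \<longleftrightarrow> Vector_Spaces.linear c0_scale c0_scale T \<and> continuous_on UNIV T"

definition invertible_c0_operator :: "('a::real_normed_field c0 \<Rightarrow> 'a c0) \<Rightarrow> bool" where
  "invertible_c0_operator T \<longleftrightarrow> c0_operator T \<and> bij T \<and> continuous_on UNIV (inv T)"

definition weighted_backward_shift ::
    "(int \<Rightarrow> 'a::real_normed_field) \<Rightarrow> (int \<Rightarrow> 'a) \<Rightarrow> (int \<Rightarrow> 'a)" where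
  "weighted_backward_shift w x = (\<lambda>n. w (n + 1) * x (n + 1))"

text \<open>
  The formula for the shift makes sense on all sequences, but need not preserve
  \<open>c\<^sub>0\<close> when the weights are unbounded. That \<open>T\<close> is the shift as a map on \<open>c\<^sub>0\<close>
  includes the fact that it does; such a \<open>T\<close> is unique.
\<close>

definition is_weighted_backward_shift ::
    "(int \<Rightarrow> 'a::real_normed_field) \<Rightarrow> ('a c0 \<Rightarrow> 'a c0) \<Rightarrow> bool" where
  "is_weighted_backward_shift w T \<longleftrightarrow>
     (\<forall>x. c0_nth (T x) = weighted_backward_shift w (c0_nth x))"

definition upper_density :: "nat set \<Rightarrow> ereal" where
  "upper_density A = limsup (\<lambda>N. ereal (real (card {n \<in> A. n \<le> N}) / real (N + 1)))"

definition upper_frequently_hypercyclic :: "('b::topological_space \<Rightarrow> 'b) \<Rightarrow> bool" where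
  "upper_frequently_hypercyclic T \<longleftrightarrow>
     (\<exists>x. \<forall>U. open U \<and> U \<noteq> {} \<longrightarrow> upper_density {n. (T ^^ n) x \<in> U} > 0)"

end

theory Submission
  imports Defs
begin

text \<open>
  Let \<open>W j\<close> be the product of the weights from \<open>1\<close> to \<open>j\<close>, continued to negative \<open>j\<close> so that
  \<open>W (j + 1) = w (j + 1) * W j\<close>. Then \<open>(B\<^sup>n x)\<^sub>j = W (j + n) / W j * x\<^sub>j\<^sub>+\<^sub>n\<close> for every integer \<open>n\<close>: in the
  coordinates \<open>W j * x\<^sub>j\<close> the operator is a plain translation. Hence \<open>B\<^sup>k v\<close> is small for a
  finitely supported \<open>v\<close> as soon as \<open>W (- k)\<close> is large.

  The point is that the information about \<open>W\<close> carried by the orbit of a vector is symmetric under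
  reversal of time. Let \<open>x\<close> be close to a large multiple of the unit vector \<open>e\<^sub>0\<close>, and let \<open>F\<close> be
  a set of times \<open>n \<ge> 1\<close> with \<open>B\<^sup>n x\<close> close to a fixed multiple of \<open>e\<^sub>0\<close>. Comparing coordinates
  shows that \<open>W n\<close> and \<open>W (- n)\<close> are both large for \<open>n \<in> F\<close>, and that \<open>W (n - m)\<close> is large for
  all distinct \<open>m, n \<in> F\<close>, whatever the sign of \<open>n - m\<close> (\<open>return_times_W_large\<close>). The size at
  \<open>n\<close> and \<open>- n\<close> is governed by how large and how precisely approximated the starting multiple is;
  the size at the differences depends only on the target. The vectors of one orbit all have the
  same upper density of visits to the target, so \<open>F\<close> can be chosen with a density that does not
  depend on the starting multiple (\<open>large_difference_sets\<close>).

  For finitely supported \<open>u, v\<close> put \<open>z = u + (\<Sum>m\<in>F. B\<^sup>m v)\<close>. Since \<open>W (- m)\<close> is large, \<open>z\<close> is close to \<open>u\<close>.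
  Since \<open>W n\<close> and all \<open>W (n - m)\<close> are large, \<open>B\<^sup>-\<^sup>n z\<close> is close to \<open>v\<close> for all \<open>n \<in> F\<close>
  (\<open>inverse_orbit_approximation\<close>). So vectors arbitrarily close to any \<open>u\<close> visit a neighbourhood
  of \<open>v\<close> under \<open>B\<^sup>-\<^sup>1\<close> with a frequency that depends on that neighbourhood alone, and by the Baire
  category theorem this is enough for upper frequent hypercyclicity
  (\<open>upper_frequently_hypercyclicI\<close>).
\<close>

section \<open>Positive upper density\<close>

lemma upper_density_pos_iff:
  "upper_density A > 0 \<longleftrightarrow>
     (\<exists>\<delta>>0. \<forall>N\<^sub>0. \<exists>N\<ge>N\<^sub>0. \<delta> * real (N + 1) \<le> real (card {n \<in> A. n \<le> N}))"
proof -
  define r where "r N = real (card {n \<in> A. n \<le> N}) / real (N + 1)" for N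
  have "upper_density A \<le> 0 \<longleftrightarrow> (\<forall>y>0. \<forall>\<^sub>F N in sequentially. ereal (r N) < y)"
    unfolding upper_density_def r_def by (rule Limsup_le_iff)
  also have "\<dots> \<longleftrightarrow> (\<forall>\<delta>>0. \<forall>\<^sub>F N in sequentially. r N < \<delta>)"
  proof (intro iffI allI impI)
    fix \<delta> :: real
    assume "\<forall>y>0. \<forall>\<^sub>F N in sequentially. ereal (r N) < y" "\<delta> > 0"
    then have "\<forall>\<^sub>F N in sequentially. ereal (r N) < ereal \<delta>"
      by (metis ereal_less(2))
    then show "\<forall>\<^sub>F N in sequentially. r N < \<delta>" by simp
  next
    fix y :: ereal
    assume *: "\<forall>\<delta>>0. \<forall>\<^sub>F N in sequentially. r N < \<delta>" and "y > 0"
    obtain \<delta> where \<delta>: "0 < \<delta>" "ereal \<delta> < y"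
      using ereal_dense2[OF \<open>y > 0\<close>] by (auto simp: zero_ereal_def)
    from \<delta>(1) * have "\<forall>\<^sub>F N in sequentially. r N < \<delta>" by blast
    then show "\<forall>\<^sub>F N in sequentially. ereal (r N) < y"
      by eventually_elim (use \<delta>(2) in \<open>auto intro: less_trans[of _ "ereal \<delta>"]\<close>)
  qed
  finally have "upper_density A > 0 \<longleftrightarrow> \<not> (\<forall>\<delta>>0. \<exists>N\<^sub>0. \<forall>N\<ge>N\<^sub>0. r N < \<delta>)"
    unfolding eventually_sequentially by (metis not_le)
  also have "\<dots> \<longleftrightarrow> (\<exists>\<delta>>0. \<forall>N\<^sub>0. \<exists>N\<ge>N\<^sub>0. \<delta> \<le> r N)"
    by (simp add: not_less)
  finally show ?thesis by (simp add: r_def pos_le_divide_eq)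
qed

lemma upper_density_pos_nonempty: "upper_density A > 0 \<Longrightarrow> A \<noteq> {}"
  by (auto simp: upper_density_pos_iff mult_le_0_iff)

section \<open>A category criterion for upper frequent hypercyclicity\<close>

lemma open_dense_countable_Inter_nonempty:
  fixes \<G> :: "'b::complete_space set set"
  assumes "countable \<G>" "\<And>G. G \<in> \<G> \<Longrightarrow> open G" "\<And>G. G \<in> \<G> \<Longrightarrow> closure G = UNIV"
  shows "\<Inter>\<G> \<noteq> {}"
proof -
  have "Met_TC.mtopology closure_of \<Inter>\<G> = (UNIV :: 'b set)"
    using assms by (intro Met_TC.metric_Baire_category) (auto simp: complete_UNIV)
  then show ?thesis by (auto simp: closure_of_eq_empty_gen)
qed

lemma continuous_on_funpow:
  fixes T :: "'b::topological_space \<Rightarrow> 'b"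
  assumes "continuous_on UNIV T"
  shows "continuous_on UNIV (T ^^ n)"
proof (induction n)
  case (Suc n)
  then have "continuous_on UNIV (T \<circ> T ^^ n)"
    by (rule continuous_on_compose) (rule continuous_on_subset[OF assms], simp)
  then show ?case by simp
qed (simp add: id_def)

text \<open>
  The order of the quantifiers is what makes this usable: the frequency \<open>\<delta>\<close> may depend on the target
  \<open>v\<close> and the precision \<open>e\<close>, but not on the starting region or on \<open>N\<^sub>0\<close>. For fixed \<open>v\<close>, \<open>e\<close> and
  \<open>N\<^sub>0\<close>, visiting with frequency \<open>\<delta>\<close> up to some time \<open>N \<ge> N\<^sub>0\<close> is an open condition on the
  starting point, because it involves finitely many iterates, and it is dense by hypothesis. Any
  point in the countable intersection of these sets has the required orbit.
\<close>
lemma upper_frequently_hypercyclicI: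
  fixes T :: "'b::complete_space \<Rightarrow> 'b"
  assumes cont: "continuous_on UNIV T"
    and D: "countable D" "closure D = UNIV"
    and visits: "\<And>v e. v \<in> D \<Longrightarrow> 0 < e \<Longrightarrow> \<exists>\<delta>>0. \<forall>u\<in>D. \<forall>\<eta>>0. \<forall>N\<^sub>0. \<exists>z. \<exists>N\<ge>N\<^sub>0.
      dist z u < \<eta> \<and> \<delta> * real (N + 1) \<le> real (card {n. n \<le> N \<and> dist ((T ^^ n) z) v < e})"
  shows "upper_frequently_hypercyclic T"
proof -
  define \<epsilon> where "\<epsilon> k = 1 / real (Suc k)" for k
  define often where "often \<delta> v k N\<^sub>0 = {z. \<exists>N\<ge>N\<^sub>0. \<delta> * real (N + 1) \<le>
    real (card {n. n \<le> N \<and> dist ((T ^^ n) z) v < \<epsilon> k})}" for \<delta> v k N\<^sub>0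
  have "\<exists>\<delta>>0. \<forall>u\<in>D. \<forall>\<eta>>0. \<forall>N\<^sub>0. \<exists>z\<in>often \<delta> v k N\<^sub>0. dist z u < \<eta>" if v: "v \<in> D" for v k
  proof -
    have "\<epsilon> k > 0" by (simp add: \<epsilon>_def)
    from visits[OF v this] obtain \<delta> where "\<delta> > 0" and
      \<delta>: "\<forall>u\<in>D. \<forall>\<eta>>0. \<forall>N\<^sub>0. \<exists>z. \<exists>N\<ge>N\<^sub>0. dist z u < \<eta> \<and>
        \<delta> * real (N + 1) \<le> real (card {n. n \<le> N \<and> dist ((T ^^ n) z) v < \<epsilon> k})"
      by (elim exE conjE)
    have "\<exists>z\<in>often \<delta> v k N\<^sub>0. dist z u < \<eta>" if "u \<in> D" "\<eta> > 0" for u \<eta> N\<^sub>0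
      using \<delta>[rule_format, OF that, of N\<^sub>0] unfolding often_def mem_Collect_eq Bex_def by meson
    with \<open>\<delta> > 0\<close> show ?thesis by meson
  qed
  then obtain \<delta> where \<delta>: "\<And>v k. v \<in> D \<Longrightarrow> \<delta> v k > 0" and
    near: "\<And>v k u \<eta> N\<^sub>0. v \<in> D \<Longrightarrow> u \<in> D \<Longrightarrow> \<eta> > 0 \<Longrightarrow> \<exists>z\<in>often (\<delta> v k) v k N\<^sub>0. dist z u < \<eta>"
    by metis
  let ?G = "\<lambda>(v, k, N\<^sub>0). often (\<delta> v k) v k N\<^sub>0"
  have "\<Inter>(?G ` (D \<times> UNIV)) \<noteq> {}"
  proof (rule open_dense_countable_Inter_nonempty)
    show "countable (?G ` (D \<times> UNIV))" using D(1) by simp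
  next
    fix G assume "G \<in> ?G ` (D \<times> UNIV)"
    then obtain v k N\<^sub>0 where v: "v \<in> D" and G: "G = often (\<delta> v k) v k N\<^sub>0" by auto
    \<comment> \<open>The cardinality condition is a union, over the finite sets \<open>F\<close> of visiting times that are large
      enough, of finite intersections of open sets.\<close>
    have "open ({z. dist ((T ^^ n) z) v < \<epsilon> k})" for n
      by (intro open_Collect_less continuous_intros continuous_on_funpow cont)
    then have "open (\<Union>N\<in>{N\<^sub>0..}. \<Union>F\<in>{F. F \<subseteq> {..N} \<and> \<delta> v k * real (N + 1) \<le> real (card F)}.
        \<Inter>n\<in>F. {z. dist ((T ^^ n) z) v < \<epsilon> k})" (is "open ?H")
      by (intro open_UN ballI open_INT) (auto intro: finite_subset)
    also have "?H = G"
    proof (intro set_eqI iffI)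
      fix z assume "z \<in> ?H"
      then obtain N F where *: "N \<ge> N\<^sub>0" "F \<subseteq> {..N}" "\<delta> v k * real (N + 1) \<le> real (card F)"
        "\<forall>n\<in>F. dist ((T ^^ n) z) v < \<epsilon> k" by auto
      then have "card F \<le> card {n. n \<le> N \<and> dist ((T ^^ n) z) v < \<epsilon> k}"
        by (intro card_mono) auto
      with * show "z \<in> G" unfolding G often_def by (intro CollectI exI[of _ N]) linarith
    next
      fix z assume "z \<in> G"
      then obtain N where "N \<ge> N\<^sub>0"
        "\<delta> v k * real (N + 1) \<le> real (card {n. n \<le> N \<and> dist ((T ^^ n) z) v < \<epsilon> k})"
        unfolding G often_def by blast
      then show "z \<in> ?H"
        by (intro UN_I[of N] UN_I[of "{n. n \<le> N \<and> dist ((T ^^ n) z) v < \<epsilon> k}"]) auto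
    qed
    finally show "open G" .
    have "y \<in> closure G" for y
    proof (unfold closure_approachable, intro allI impI)
      fix e :: real assume "e > 0"
      have "y \<in> closure D" using D(2) by simp
      then obtain u where u: "u \<in> D" "dist u y < e / 2"
        using \<open>e > 0\<close> by (meson closure_approachable half_gt_zero)
      obtain z where z: "z \<in> G" "dist z u < e / 2"
        using near[OF v u(1), of "e / 2"] \<open>e > 0\<close> unfolding G by force
      have "dist z y < e" using u(2) z(2) dist_triangle[of z y u] by linarith
      with z(1) show "\<exists>z\<in>G. dist z y < e" by blast
    qed
    then show "closure G = UNIV" by blast
  qed
  then obtain z where z: "\<And>v k N\<^sub>0. v \<in> D \<Longrightarrow> z \<in> often (\<delta> v k) v k N\<^sub>0" by auto
  have "upper_density {n. (T ^^ n) z \<in> U} > 0" if U: "open U" "U \<noteq> {}" for U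
  proof -
    obtain y where "y \<in> U" using U(2) by blast
    then obtain v where v: "v \<in> D" "v \<in> U"
      using D(2) U(1) by (metis UNIV_I closure_iff_nhds_not_empty disjoint_iff order_refl)
    then obtain e where e: "e > 0" "ball v e \<subseteq> U" using U(1) open_contains_ball by metis
    obtain k where k: "\<epsilon> k < e" using nat_approx_posE[OF e(1)] unfolding \<epsilon>_def by blast
    have "\<exists>N\<ge>N\<^sub>0. \<delta> v k * real (N + 1) \<le> real (card {n \<in> {n. (T ^^ n) z \<in> U}. n \<le> N})" for N\<^sub>0
    proof -
      obtain N where N: "N \<ge> N\<^sub>0"
        "\<delta> v k * real (N + 1) \<le> real (card {n. n \<le> N \<and> dist ((T ^^ n) z) v < \<epsilon> k})"
        using z[OF v(1), of k N\<^sub>0] unfolding often_def by blast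
      have "card {n. n \<le> N \<and> dist ((T ^^ n) z) v < \<epsilon> k} \<le> card {n \<in> {n. (T ^^ n) z \<in> U}. n \<le> N}"
        using e(2) k by (intro card_mono) (auto simp: dist_commute subset_eq)
      with N show ?thesis by (intro exI[of _ N]) linarith
    qed
    then show ?thesis unfolding upper_density_pos_iff using \<delta>[OF v(1)] by blast
  qed
  then show ?thesis unfolding upper_frequently_hypercyclic_def by blast
qed

section \<open>Finitely supported sequences\<close>

lemma c0_nth_Abs_finite_support:
  fixes f :: "int \<Rightarrow> 'a::real_normed_vector"
  assumes "\<And>j. p < \<bar>j\<bar> \<Longrightarrow> f j = 0"
  shows "c0_nth (Abs_c0 f) = f"
proof (rule Abs_c0_inverse, rule CollectI, rule tendsto_eventually)
  show "\<forall>\<^sub>F j in filtercomap abs at_top. f j = 0"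
    unfolding eventually_filtercomap_at_top_linorder using assms
    by (intro exI[of _ "p + 1"]) auto
qed

definition c0_finite_support :: "'a::real_normed_vector c0 set" where
  "c0_finite_support = {x. \<exists>p. \<forall>j. p < \<bar>j\<bar> \<longrightarrow> c0_nth x j = 0}"

lemma countable_dense_finite_support:
  obtains D :: "'a::{real_normed_vector, second_countable_topology} c0 set"
  where "countable D" "closure D = UNIV" "D \<subseteq> c0_finite_support"
proof -
  obtain E :: "'a set" where E: "countable E" "\<And>X. open X \<Longrightarrow> X \<noteq> {} \<Longrightarrow> \<exists>d\<in>E. d \<in> X"
    using countable_dense_setE by blast
  define trunc where "trunc n f j = (if \<bar>j\<bar> \<le> int n then f j else (0::'a))" for n f j
  have nth: "c0_nth (Abs_c0 (trunc n f)) = trunc n f" for n f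
    by (rule c0_nth_Abs_finite_support[of "int n"]) (simp add: trunc_def)
  define D where "D = (\<Union>n. (\<lambda>f. Abs_c0 (trunc n f)) ` (PiE {- int n..int n} (\<lambda>_. E)))"
  have "countable D"
    unfolding D_def using E(1) by (intro countable_UN countable_image countable_PiE) auto
  moreover have "D \<subseteq> c0_finite_support"
    unfolding D_def c0_finite_support_def using nth by (auto simp: trunc_def not_le[symmetric])
  moreover have "x \<in> closure D" for x
    unfolding closure_approachable
  proof (intro allI impI)
    fix e :: real assume "e > 0"
    have "\<forall>\<^sub>F j in filtercomap abs at_top. dist (c0_nth x j) 0 < e / 2"
      using c0_nth_tendsto \<open>e > 0\<close> by (intro tendstoD) auto
    then obtain M where M: "\<And>j. \<bar>j\<bar> \<ge> M \<Longrightarrow> norm (c0_nth x j) < e / 2"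
      unfolding eventually_filtercomap_at_top_linorder by auto
    define n where "n = nat M"
    have "\<exists>d\<in>E. dist (c0_nth x j) d < e / 2" for j
      using E(2)[of "ball (c0_nth x j) (e / 2)"] \<open>e > 0\<close> by auto
    then obtain d where d: "\<And>j. d j \<in> E" "\<And>j. dist (c0_nth x j) (d j) < e / 2" by metis
    define f where "f = restrict d {- int n..int n}"
    have "Abs_c0 (trunc n f) \<in> D"
      unfolding D_def f_def using d(1) by (intro UN_I[of n] imageI) auto
    moreover have "norm (Abs_c0 (trunc n f) - x) \<le> e / 2"
    proof (rule norm_c0_le)
      fix j
      show "norm (c0_nth (Abs_c0 (trunc n f) - x) j) \<le> e / 2"
      proof (cases "\<bar>j\<bar> \<le> int n")
        case True
        then have "c0_nth (Abs_c0 (trunc n f) - x) j = d j - c0_nth x j"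
          by (auto simp: minus_c0.rep_eq nth trunc_def f_def)
        then show ?thesis using d(2)[of j] by (simp add: dist_norm norm_minus_commute)
      next
        case False
        then have "norm (c0_nth x j) < e / 2" by (intro M) (auto simp: n_def split: if_splits)
        with False show ?thesis by (auto simp: minus_c0.rep_eq nth trunc_def)
      qed
    qed
    ultimately show "\<exists>y\<in>D. dist y x < e"
      using \<open>e > 0\<close> by (intro bexI[of _ "Abs_c0 (trunc n f)"]) (auto simp: dist_norm)
  qed
  ultimately show thesis using that by blast
qed

lemma c0_nth_sum: "c0_nth (\<Sum>i\<in>I. f i) j = (\<Sum>i\<in>I. c0_nth (f i) j)"
  by (induction I rule: infinite_finite_induct) (auto simp: zero_c0.rep_eq plus_c0.rep_eq)

definition c0_spike :: "int \<Rightarrow> 'a::real_normed_vector \<Rightarrow> 'a c0" where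
  "c0_spike i a = Abs_c0 (\<lambda>j. if j = i then a else 0)"

lemma c0_nth_spike [simp]: "c0_nth (c0_spike i a) j = (if j = i then a else 0)"
  unfolding c0_spike_def
  by (subst c0_nth_Abs_finite_support[of "\<bar>i\<bar>"]) auto

lemma norm_c0_spike_le: "norm (c0_spike i a) \<le> norm a"
  by (rule norm_c0_le) simp

section \<open>Weighted shifts in terms of products of weights\<close>

text \<open>
  The value at negative \<open>j\<close> is forced by the recurrence \<open>weight_prod_step\<close>.
\<close>
definition weight_prod :: "(int \<Rightarrow> 'a::field) \<Rightarrow> int \<Rightarrow> 'a" where
  "weight_prod w j = (if 0 \<le> j then \<Prod>i\<in>{1..j}. w i else inverse (\<Prod>i\<in>{j+1..0}. w i))"

lemma weight_prod_0 [simp]: "weight_prod w 0 = 1"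
  by (simp add: weight_prod_def)

lemma weight_prod_nonzero: "(\<And>n. w n \<noteq> 0) \<Longrightarrow> weight_prod w j \<noteq> 0"
  by (simp add: weight_prod_def)

lemma weight_prod_step:
  assumes "\<And>n. w n \<noteq> 0"
  shows "weight_prod w (j + 1) = w (j + 1) * weight_prod w j"
proof -
  consider "j \<ge> 0" | "j = -1" | "j < -1" by linarith
  then show ?thesis
  proof cases
    case 1
    then have "{1..j+1} = insert (j+1) {1..j}" by auto
    with 1 show ?thesis by (simp add: weight_prod_def)
  next
    case 2
    then show ?thesis using assms[of 0] by (simp add: weight_prod_def)
  next
    case 3
    then have "{j+1..0} = insert (j+1) {j+2..0}" by auto
    with 3 show ?thesis using assms[of "j + 1"] by (simp add: weight_prod_def add.assoc)
  qed
qed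

locale invertible_shift =
  fixes w :: "int \<Rightarrow> 'a::real_normed_field" and B :: "'a c0 \<Rightarrow> 'a c0"
  assumes weight_nonzero: "\<And>n. w n \<noteq> 0"
    and is_shift: "is_weighted_backward_shift w B"
    and invertible: "invertible_c0_operator B"
begin

abbreviation W :: "int \<Rightarrow> 'a" where "W \<equiv> weight_prod w"

lemma W_nonzero [simp]: "W j \<noteq> 0"
  by (intro weight_prod_nonzero weight_nonzero)

lemma W_step: "W (j + 1) = w (j + 1) * W j"
  by (intro weight_prod_step weight_nonzero)

lemma nth_B: "c0_nth (B x) j = W (j + 1) / W j * c0_nth x (j + 1)"
  using is_shift W_step[of j]
  by (simp add: is_weighted_backward_shift_def weighted_backward_shift_def)

lemma nth_inv_B: "c0_nth (inv B x) j = W (j - 1) / W j * c0_nth x (j - 1)"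
proof -
  have "B (inv B x) = x"
    using invertible by (simp add: invertible_c0_operator_def bij_is_surj surj_f_inv_f)
  then have "c0_nth x (j - 1) = W j / W (j - 1) * c0_nth (inv B x) j"
    using nth_B[of "inv B x" "j - 1"] by simp
  then show ?thesis by simp
qed

lemma nth_B_pow: "c0_nth ((B ^^ n) x) j = W (j + int n) / W j * c0_nth x (j + int n)"
  by (induction n arbitrary: j) (auto simp: nth_B algebra_simps)

lemma nth_inv_B_pow: "c0_nth ((inv B ^^ n) x) j = W (j - int n) / W j * c0_nth x (j - int n)"
  by (induction n arbitrary: j) (auto simp: nth_inv_B algebra_simps)

text \<open>
  The unit vectors are bounded, so their images under the two continuous maps are bounded; the
  entries of these images are the ratios of consecutive products and their inverses.
\<close>
lemma W_ratio_bounded: "\<exists>R\<ge>1. \<forall>j. norm (W (j + 1)) \<le> R * norm (W j) \<and> norm (W j) \<le> R * norm (W (j + 1))"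
proof -
  have bounded: "\<exists>R>0. \<forall>i j. norm (c0_nth (T (c0_spike i 1)) j) \<le> R"
    if cont: "continuous_on UNIV T" and hom: "\<And>a x j. c0_nth (T x) j = g j * c0_nth x (h j)"
    for T :: "'a c0 \<Rightarrow> 'a c0" and g h
  proof -
    have T0: "T 0 = 0" by (rule c0_eqI) (simp add: hom zero_c0.rep_eq)
    have "isCont T 0" using cont by (simp add: continuous_on_eq_continuous_at)
    then obtain d where d: "d > 0" "\<And>x. norm x < d \<Longrightarrow> norm (T x) < 1"
      unfolding continuous_at_eps_delta using T0 by (metis dist_0_norm dist_commute zero_less_one)
    have "norm (c0_nth (T (c0_spike i 1)) j) \<le> 2 / d" for i j
    proof -
      have "norm (c0_spike i (of_real (d / 2) :: 'a)) < d"
        using norm_c0_spike_le[of i "of_real (d / 2) :: 'a"] d(1) by simp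
      then have "norm (c0_nth (T (c0_spike i (of_real (d / 2)))) j) < 1"
        using d(2) norm_c0_nth_le le_less_trans by metis
      moreover have "c0_nth (T (c0_spike i (of_real (d / 2)))) j =
          of_real (d / 2) * c0_nth (T (c0_spike i 1)) j"
        by (simp add: hom)
      moreover have "norm (of_real (d / 2) :: 'a) = d / 2" using d(1) by (subst norm_of_real) simp
      ultimately have "d / 2 * norm (c0_nth (T (c0_spike i 1)) j) < 1" by (simp only: norm_mult)
      then show ?thesis using d(1) by (simp add: field_simps)
    qed
    then show ?thesis using d(1) by (intro exI[of _ "2 / d"]) auto
  qed
  obtain R\<^sub>1 where R\<^sub>1: "\<And>i j. norm (c0_nth (B (c0_spike i 1)) j) \<le> R\<^sub>1"
    using bounded[OF _ nth_B] invertible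
    unfolding invertible_c0_operator_def c0_operator_def by blast
  obtain R\<^sub>2 where R\<^sub>2: "\<And>i j. norm (c0_nth (inv B (c0_spike i 1)) j) \<le> R\<^sub>2"
    using bounded[OF _ nth_inv_B] invertible
    unfolding invertible_c0_operator_def c0_operator_def by blast
  define R where "R = max 1 (max R\<^sub>1 R\<^sub>2)"
  have "norm (W (j + 1)) \<le> R * norm (W j)" for j
  proof -
    have "norm (W (j + 1)) \<le> R\<^sub>1 * norm (W j)"
      using R\<^sub>1[of "j + 1" j] by (simp add: nth_B norm_divide pos_divide_le_eq)
    also have "\<dots> \<le> R * norm (W j)" by (intro mult_right_mono) (auto simp: R_def)
    finally show ?thesis .
  qed
  moreover have "norm (W j) \<le> R * norm (W (j + 1))" for j
  proof -
    have "norm (W j) \<le> R\<^sub>2 * norm (W (j + 1))"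
      using R\<^sub>2[of j "j + 1"] by (simp add: nth_inv_B norm_divide pos_divide_le_eq)
    also have "\<dots> \<le> R * norm (W (j + 1))" by (intro mult_right_mono) (auto simp: R_def)
    finally show ?thesis .
  qed
  ultimately show ?thesis by (intro exI[of _ R]) (simp add: R_def)
qed

lemma W_window: "\<exists>C>0. \<forall>k i. \<bar>i\<bar> \<le> p \<longrightarrow> norm (W k) \<le> C * norm (W (k + i))"
proof -
  obtain R where R: "R \<ge> 1" "\<And>j. norm (W (j + 1)) \<le> R * norm (W j)"
    "\<And>j. norm (W j) \<le> R * norm (W (j + 1))"
    using W_ratio_bounded by blast
  have up: "norm (W k) \<le> R ^ n * norm (W (k + int n))" for k n
  proof (induction n)
    case (Suc n)
    have "R ^ n * norm (W (k + int n)) \<le> R ^ n * (R * norm (W (k + int n + 1)))"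
      using R by (intro mult_left_mono) auto
    with Suc show ?case by (simp add: algebra_simps)
  qed simp
  have down: "norm (W k) \<le> R ^ n * norm (W (k - int n))" for k n
  proof (induction n)
    case (Suc n)
    have "R ^ n * norm (W (k - int n)) \<le> R ^ n * (R * norm (W (k - int n - 1)))"
      using R(1) R(2)[of "k - int n - 1"] by (intro mult_left_mono) auto
    with Suc show ?case by (simp add: algebra_simps)
  qed simp
  have "norm (W k) \<le> R ^ nat p * norm (W (k + i))" if "\<bar>i\<bar> \<le> p" for k i
  proof -
    have "norm (W k) \<le> R ^ nat \<bar>i\<bar> * norm (W (k + i))"
      using up[of k "nat \<bar>i\<bar>"] down[of k "nat \<bar>i\<bar>"] by (cases "i \<ge> 0") auto
    also have "\<dots> \<le> R ^ nat p * norm (W (k + i))"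
      using that R(1) by (intro mult_right_mono power_increasing) auto
    finally show ?thesis .
  qed
  then show ?thesis using R(1) by (intro exI[of _ "R ^ nat p"]) auto
qed

text \<open>
  The left side is the \<open>j\<close>-th coordinate of \<open>B\<^sup>k v\<close>, for \<open>k\<close> of either sign. It vanishes unless
  \<open>j + k\<close> lies in the support of \<open>v\<close>, that is, unless \<open>j\<close> is within a bounded distance of \<open>- k\<close>;
  there \<open>W j\<close> is comparable to \<open>W (- k)\<close>.
\<close>
lemma shifted_finite_support_bound:
  assumes "v \<in> c0_finite_support"
  shows "\<exists>C>0. \<forall>k j. norm (W (j + k) / W j * c0_nth v (j + k)) \<le> C / norm (W (- k))"
proof -
  obtain p where p: "\<And>j. p < \<bar>j\<bar> \<Longrightarrow> c0_nth v j = 0"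
    using assms unfolding c0_finite_support_def by blast
  obtain C where C: "C > 0" "\<And>k i. \<bar>i\<bar> \<le> p \<Longrightarrow> norm (W k) \<le> C * norm (W (k + i))"
    using W_window by metis
  define A where "A = (\<Sum>i\<in>{-p..p}. norm (W i * c0_nth v i))"
  have A: "A \<ge> 0" by (simp add: A_def sum_nonneg)
  have "norm (W (j + k) / W j * c0_nth v (j + k)) \<le> C * (A + 1) / norm (W (- k))" for k j
  proof (cases "\<bar>j + k\<bar> \<le> p")
    case True
    then have "norm (W (j + k) * c0_nth v (j + k)) \<le> A"
      unfolding A_def by (intro member_le_sum) auto
    moreover have "norm (W (- k)) \<le> C * norm (W j)"
      using C(2)[OF True, of "- k"] by simp
    ultimately have "norm (W (j + k) * c0_nth v (j + k)) * norm (W (- k)) \<le> (A + 1) * (C * norm (W j))"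
      using C(1) A by (intro mult_mono) auto
    then show ?thesis by (simp add: norm_mult norm_divide divide_simps mult_ac)
  next
    case False
    then have "c0_nth v (j + k) = 0" by (intro p) simp
    then show ?thesis using C(1) A by simp
  qed
  moreover have "C * (A + 1) > 0" using C(1) A by simp
  ultimately show ?thesis by blast
qed

text \<open>
  This estimate is where the sup norm enters: at each coordinate only boundedly many of the
  translates of \<open>v\<close> are non-zero, so the bound for one term gives a bound for the sum that is
  independent of the number of terms.
\<close>
lemma sum_shifted_finite_support_bound:
  assumes "v \<in> c0_finite_support"
  shows "\<exists>C>0. \<forall>L>0. \<forall>F s j. finite F \<longrightarrow> (\<forall>m\<in>F. L \<le> norm (W (s - int m))) \<longrightarrow>
    norm (\<Sum>m\<in>F. W (j + (int m - s)) / W j * c0_nth v (j + (int m - s))) \<le> C / L"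
proof -
  obtain p where p: "\<And>j. p < \<bar>j\<bar> \<Longrightarrow> c0_nth v j = 0"
    using assms unfolding c0_finite_support_def by blast
  obtain C where C: "C > 0"
    "\<And>k j. norm (W (j + k) / W j * c0_nth v (j + k)) \<le> C / norm (W (- k))"
    using shifted_finite_support_bound[OF assms] by blast
  \<comment> \<open>The number of \<open>m\<close> for which the support of \<open>v\<close> meets a given coordinate is at most \<open>q\<close>.\<close>
  define q where "q = card {-p..p}"
  have "norm (\<Sum>m\<in>F. W (j + (int m - s)) / W j * c0_nth v (j + (int m - s))) \<le> (real q + 1) * C / L"
    if "L > 0" and F: "finite F" "\<forall>m\<in>F. L \<le> norm (W (s - int m))" for L F s j
  proof -
    let ?t = "\<lambda>m. W (j + (int m - s)) / W j * c0_nth v (j + (int m - s))"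
    define G where "G = {m \<in> F. \<bar>j + (int m - s)\<bar> \<le> p}"
    have "(\<Sum>m\<in>F. ?t m) = (\<Sum>m\<in>G. ?t m)"
      unfolding G_def using F(1) p by (intro sum.mono_neutral_right) (auto simp: not_le)
    also have "norm \<dots> \<le> (\<Sum>m\<in>G. C / L)"
    proof (rule sum_norm_le)
      fix m assume "m \<in> G"
      then have "L \<le> norm (W (s - int m))" using F(2) by (simp add: G_def)
      then have "C / norm (W (- (int m - s))) \<le> C / L"
        using C(1) \<open>L > 0\<close> by (intro divide_left_mono) auto
      with C(2)[of j "int m - s"] show "norm (?t m) \<le> C / L" by linarith
    qed
    also have "\<dots> = real (card G) * (C / L)" by simp
    also have "\<dots> \<le> (real q + 1) * (C / L)"
    proof (rule mult_right_mono)
      have "card G \<le> card {-p..p}"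
        by (rule card_inj_on_le[of "\<lambda>m. j + (int m - s)"]) (auto simp: G_def inj_on_def)
      then show "real (card G) \<le> real q + 1" by (simp add: q_def)
      show "0 \<le> C / L" using C(1) \<open>L > 0\<close> by simp
    qed
    finally show ?thesis by simp
  qed
  then show ?thesis using C(1) by (intro exI[of _ "(real q + 1) * C"]) auto
qed

section \<open>Large products along differences of return times\<close>

text \<open>
  The condition is invariant under replacing \<open>W j\<close> by \<open>W (- j)\<close>, which is the passage from \<open>B\<close> to
  its inverse up to reflection of \<open>\<int>\<close>.
\<close>
definition large_products :: "real \<Rightarrow> real \<Rightarrow> nat set \<Rightarrow> bool" where
  "large_products K L F \<longleftrightarrow>
    (\<forall>n\<in>F. K \<le> norm (W (int n)) \<and> K \<le> norm (W (- int n))) \<and>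
    (\<forall>m\<in>F. \<forall>n\<in>F. m \<noteq> n \<longrightarrow> L \<le> norm (W (int n - int m)))"

text \<open>
  Each bound comes from reading one coordinate. At a return time \<open>n\<close> the coordinate \<open>0\<close> of \<open>B\<^sup>n x\<close> is
  \<open>W n * x\<^sub>n\<close>, of size more than \<open>L\<close>, whereas \<open>x\<^sub>n\<close> is smaller than \<open>r\<close>; so \<open>W n\<close> is large. The
  coordinate \<open>- n\<close> is \<open>x\<^sub>0 / W (- n)\<close>, of size less than \<open>1\<close>, whereas \<open>x\<^sub>0\<close> exceeds \<open>K\<close>. The
  coordinate \<open>m - n\<close>, again of size less than \<open>1\<close>, is \<open>W m * x\<^sub>m / W (m - n)\<close>, and the numerator is
  the coordinate \<open>0\<close> of \<open>B\<^sup>m x\<close>.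
\<close>
lemma return_times_W_large:
  assumes "0 < L" "0 < K"
    and r: "r \<le> 1" "r * K \<le> L"
    and x: "dist x (c0_spike 0 (of_real (K + 1))) < r"
    and F: "\<And>n. n \<in> F \<Longrightarrow> 1 \<le> n \<and> dist ((B ^^ n) x) (c0_spike 0 (of_real (L + 1))) < 1"
  shows "large_products K L F"
proof -
  have coord: "norm (c0_nth y j - (if j = 0 then a else 0)) < s"
    if "dist y (c0_spike 0 a) < s" for y and a :: 'a and s j
    using norm_c0_nth_le[of "y - c0_spike 0 a" j] that by (simp add: minus_c0.rep_eq dist_norm)
  have centre: "b < norm (c0_nth y 0)"
    if "dist y (c0_spike 0 (of_real (b + 1))) < s" "s \<le> 1" "0 < b"
    for y :: "'a c0" and b s
  proof -
    have "norm (of_real (b + 1) :: 'a) = b + 1" using \<open>0 < b\<close> by (subst norm_of_real) simp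
    moreover have "norm (of_real (b + 1) - c0_nth y 0) < s"
      using coord[OF that(1), of 0] by (simp add: norm_minus_commute)
    ultimately show ?thesis
      using norm_triangle_ineq2[of "of_real (b + 1)" "c0_nth y 0"] \<open>s \<le> 1\<close> by linarith
  qed
  have x0: "K < norm (c0_nth x 0)" using centre[OF x r(1) \<open>0 < K\<close>] .
  have r0: "r > 0" using x by (rule le_less_trans[OF zero_le_dist])
  have Fc: "L < norm (c0_nth ((B ^^ n) x) 0)" if "n \<in> F" for n
    using centre[of _ L 1] F[OF that] \<open>0 < L\<close> by blast
  have Fo: "norm (c0_nth ((B ^^ n) x) j) < 1" if "n \<in> F" "j \<noteq> 0" for n j
    using coord[of "(B ^^ n) x" _ 1 j] F[OF that(1)] that(2) by fastforce
  have diff: "L \<le> norm (W (int m - int n))" if "m \<in> F" "n \<in> F" "m \<noteq> n" for m n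
  proof -
    have "norm (W (int m)) * norm (c0_nth x (int m)) > L"
      using Fc[OF that(1)] by (simp add: nth_B_pow norm_mult)
    moreover have "norm (W (int m)) * norm (c0_nth x (int m)) < norm (W (int m - int n))"
      using Fo[OF that(2), of "int m - int n"] that(3)
      by (simp add: nth_B_pow norm_mult norm_divide divide_simps)
    ultimately show ?thesis by linarith
  qed
  have "K \<le> norm (W (int n))" "K \<le> norm (W (- int n))" if "n \<in> F" for n
  proof -
    have n: "int n \<noteq> 0" using F[OF that] by simp
    have "norm (c0_nth x (int n)) < r" using coord[OF x, of "int n"] n by simp
    then have "norm (W (int n)) * norm (c0_nth x (int n)) \<le> norm (W (int n)) * r"
      by (intro mult_left_mono) auto
    moreover have "L < norm (W (int n)) * norm (c0_nth x (int n))"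
      using Fc[OF that] by (simp add: nth_B_pow norm_mult)
    ultimately have "r * K < norm (W (int n)) * r" using r(2) by linarith
    then show "K \<le> norm (W (int n))" using r0 by (simp add: mult.commute[of r])
    have "norm (c0_nth x 0) < norm (W (- int n))"
      using Fo[OF that, of "- int n"] n by (simp add: nth_B_pow norm_mult norm_divide divide_simps)
    then show "K \<le> norm (W (- int n))" using x0 by linarith
  qed
  with diff show ?thesis by (auto simp: large_products_def)
qed

text \<open>
  The essential feature is that \<open>\<delta>\<close> depends on \<open>L\<close> only. It is read off from the visits of a fixed
  vector \<open>x\<close> to a ball determined by \<open>L\<close>. The parameter \<open>K\<close> is then met by moving along the orbit
  to some \<open>B\<^sup>M x\<close>, which does not change the upper density of the visits.
\<close>
lemma large_difference_sets:
  assumes "upper_frequently_hypercyclic B" "L > 0"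
  shows "\<exists>\<delta>>0. \<forall>K>0. \<forall>N\<^sub>0. \<exists>N\<ge>N\<^sub>0. \<exists>F\<subseteq>{1..N}. \<delta> * real (N + 1) \<le> real (card F) \<and>
    large_products K L F"
proof -
  obtain x where x: "\<And>U. open U \<Longrightarrow> U \<noteq> {} \<Longrightarrow> upper_density {n. (B ^^ n) x \<in> U} > 0"
    using assms(1) unfolding upper_frequently_hypercyclic_def by blast
  define V where "V = ball (c0_spike 0 (of_real (L + 1) :: 'a)) 1"
  have "upper_density {n. (B ^^ n) x \<in> V} > 0" by (rule x) (auto simp: V_def)
  then obtain \<delta> where \<delta>: "\<delta> > 0"
    "\<And>N\<^sub>0. \<exists>N\<ge>N\<^sub>0. \<delta> * real (N + 1) \<le> real (card {n. (B ^^ n) x \<in> V \<and> n \<le> N})"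
    unfolding upper_density_pos_iff by auto
  have "\<exists>N\<ge>N\<^sub>0. \<exists>F\<subseteq>{1..N}. \<delta> / 2 * real (N + 1) \<le> real (card F) \<and>
    large_products K L F" if "K > 0" for K N\<^sub>0
  proof -
    define r where "r = min 1 (L / K)"
    have r: "r \<le> 1" "r * K \<le> L" "r > 0"
      using \<open>K > 0\<close> \<open>L > 0\<close> by (auto simp: r_def min_def field_simps)
    have "upper_density {n. (B ^^ n) x \<in> ball (c0_spike 0 (of_real (K + 1))) r} > 0"
      using r(3) by (intro x) auto
    then obtain M where M: "(B ^^ M) x \<in> ball (c0_spike 0 (of_real (K + 1))) r"
      using upper_density_pos_nonempty by blast
    \<comment> \<open>Passing from \<open>x\<close> to \<open>B\<^sup>M x\<close>, and discarding the time \<open>0\<close>, loses at most \<open>M + 1\<close> visits, which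
      from \<open>N\<^sub>1\<close> on is at most half of the guaranteed number.\<close>
    obtain N\<^sub>1 :: nat where N\<^sub>1: "2 * real (M + 1) / \<delta> \<le> real N\<^sub>1" using real_arch_simple by blast
    obtain N where N: "N \<ge> max N\<^sub>0 N\<^sub>1"
      "\<delta> * real (N + 1) \<le> real (card {n. (B ^^ n) x \<in> V \<and> n \<le> N})"
      using \<delta>(2) by blast
    define F where "F = {n \<in> {1..N}. (B ^^ n) ((B ^^ M) x) \<in> V}"
    have "{n. (B ^^ n) x \<in> V \<and> n \<le> N} \<subseteq> {..M} \<union> (\<lambda>n. n + M) ` F"
    proof
      fix n assume n: "n \<in> {n. (B ^^ n) x \<in> V \<and> n \<le> N}"
      show "n \<in> {..M} \<union> (\<lambda>n. n + M) ` F"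
      proof (cases "n \<le> M")
        case False
        then have "(B ^^ (n - M)) ((B ^^ M) x) = (B ^^ n) x"
          by (simp flip: funpow_add comp_apply[of "B ^^ (n - M)"])
        with n False have "n - M \<in> F" by (auto simp: F_def)
        with False show ?thesis by (intro UnI2 image_eqI[of _ _ "n - M"]) auto
      qed simp
    qed
    then have "card {n. (B ^^ n) x \<in> V \<and> n \<le> N} \<le> card ({..M} \<union> (\<lambda>n. n + M) ` F)"
      by (intro card_mono) (auto simp: F_def)
    also have "\<dots> \<le> (M + 1) + card F"
      using card_Un_le[of "{..M}" "(\<lambda>n. n + M) ` F"] card_image_le[of F "\<lambda>n. n + M"]
      by (simp add: F_def)
    finally have "\<delta> * real (N + 1) \<le> real (M + 1) + real (card F)" using N(2) by linarith
    moreover have "real (M + 1) \<le> \<delta> / 2 * real (N + 1)"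
    proof -
      have "2 * real (M + 1) / \<delta> \<le> real (N + 1)" using N(1) N\<^sub>1 by simp
      then show ?thesis using \<delta>(1) by (simp add: field_simps)
    qed
    ultimately have card: "\<delta> / 2 * real (N + 1) \<le> real (card F)" by (simp add: field_simps)
    have "dist ((B ^^ M) x) (c0_spike 0 (of_real (K + 1))) < r"
      using M by (simp add: dist_commute)
    moreover have "1 \<le> n \<and> dist ((B ^^ n) ((B ^^ M) x)) (c0_spike 0 (of_real (L + 1))) < 1"
      if "n \<in> F" for n
      using that by (simp add: F_def V_def dist_commute)
    ultimately have "large_products K L F"
      using return_times_W_large[OF \<open>L > 0\<close> \<open>K > 0\<close> r(1,2)] by blast
    moreover have "F \<subseteq> {1..N}" by (auto simp: F_def)
    ultimately show ?thesis using card N(1) by (intro exI[of _ N] conjI exI[of _ F]) auto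
  qed
  then show ?thesis using \<delta>(1) by (intro exI[of _ "\<delta> / 2"]) auto
qed

section \<open>Orbits of the inverse\<close>

text \<open>
  The threshold \<open>L\<close> for the differences is fixed before \<open>u\<close> and \<open>\<eta>\<close> are known. This matches
  \<open>large_difference_sets\<close>, where the frequency depends on \<open>L\<close>, and it is possible because \<open>u\<close>
  enters only through \<open>W n\<close> with \<open>n \<in> F\<close>, and the distance from \<open>z\<close> to \<open>u\<close> only through
  \<open>W (- m)\<close> with \<open>m \<in> F\<close>, both of which are controlled by \<open>K\<close>.
\<close>
lemma inverse_orbit_approximation:
  assumes v: "v \<in> c0_finite_support" and "e > 0"
  shows "\<exists>L>0. \<forall>u\<in>c0_finite_support. \<forall>\<eta>>0. \<exists>K>0. \<forall>F. finite F \<longrightarrow>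
    large_products K L F \<longrightarrow>
    (\<exists>z. dist z u < \<eta> \<and> (\<forall>n\<in>F. dist ((inv B ^^ n) z) v < e))"
proof -
  obtain C where C: "C > 0" "\<And>L F s j. L > 0 \<Longrightarrow> finite F \<Longrightarrow> \<forall>m\<in>F. L \<le> norm (W (s - int m)) \<Longrightarrow>
    norm (\<Sum>m\<in>F. W (j + (int m - s)) / W j * c0_nth v (j + (int m - s))) \<le> C / L"
    using sum_shifted_finite_support_bound[OF v] by (elim exE conjE) blast
  define L where "L = 4 * C / e"
  have L: "L > 0" "C / L = e / 4" using C(1) \<open>e > 0\<close> by (auto simp: L_def)
  have "\<exists>K>0. \<forall>F. finite F \<longrightarrow>
    large_products K L F \<longrightarrow>
    (\<exists>z. dist z u < \<eta> \<and> (\<forall>n\<in>F. dist ((inv B ^^ n) z) v < e))"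
    if u: "u \<in> c0_finite_support" and "\<eta> > 0" for u \<eta>
  proof -
    obtain A where A: "A > 0"
      "\<And>k j. norm (W (j + k) / W j * c0_nth u (j + k)) \<le> A / norm (W (- k))"
      using shifted_finite_support_bound[OF u] by blast
    define K where "K = max (2 * C / \<eta>) (4 * A / e)"
    have K: "K > 0" using C(1) \<open>\<eta> > 0\<close> by (simp add: K_def less_max_iff_disj)
    have CK: "C / K \<le> \<eta> / 2"
      using K \<open>\<eta> > 0\<close> max.cobounded1[of "2 * C / \<eta>" "4 * A / e"]
      by (fold K_def) (simp add: field_simps)
    have AK: "A / K \<le> e / 4"
      using K \<open>e > 0\<close> max.cobounded2[of "4 * A / e" "2 * C / \<eta>"]
      by (fold K_def) (simp add: field_simps)
    have "\<exists>z. dist z u < \<eta> \<and> (\<forall>n\<in>F. dist ((inv B ^^ n) z) v < e)"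
      if F: "finite F" and "large_products K L F" for F
    proof (intro exI conjI ballI)
      from \<open>large_products K L F\<close> have
        large: "\<forall>n\<in>F. K \<le> norm (W (int n)) \<and> K \<le> norm (W (- int n))" and
        diff: "\<forall>m\<in>F. \<forall>n\<in>F. m \<noteq> n \<longrightarrow> L \<le> norm (W (int n - int m))"
        unfolding large_products_def by blast+
      define z where "z = u + (\<Sum>m\<in>F. (B ^^ m) v)"
      have z: "c0_nth z j = c0_nth u j + (\<Sum>m\<in>F. W (j + int m) / W j * c0_nth v (j + int m))" for j
        by (simp add: z_def plus_c0.rep_eq c0_nth_sum nth_B_pow)
      have "norm (z - u) \<le> \<eta> / 2"
      proof (rule norm_c0_le)
        fix j
        have "norm (\<Sum>m\<in>F. W (j + (int m - 0)) / W j * c0_nth v (j + (int m - 0))) \<le> C / K"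
          using large by (intro C(2) K F) auto
        then show "norm (c0_nth (z - u) j) \<le> \<eta> / 2"
          using order_trans[OF _ CK] by (simp add: minus_c0.rep_eq z)
      qed
      with \<open>\<eta> > 0\<close> show "dist z u < \<eta>" by (simp add: dist_norm)
      fix n assume n: "n \<in> F"
      let ?t = "\<lambda>j m. W (j + (int m - int n)) / W j * c0_nth v (j + (int m - int n))"
      have "norm ((inv B ^^ n) z - v) \<le> e / 2"
      proof (rule norm_c0_le)
        fix j
        have "c0_nth ((inv B ^^ n) z) j =
            W (j - int n) / W j * c0_nth u (j - int n) + (\<Sum>m\<in>F. ?t j m)"
          unfolding nth_inv_B_pow z distrib_left sum_distrib_left
          by (intro arg_cong2[of _ _ _ _ "(+)"] sum.cong) (simp_all add: add_diff_eq diff_add_eq)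
        \<comment> \<open>The term \<open>m = n\<close> reproduces \<open>v\<close>; all the others are errors.\<close>
        also have "(\<Sum>m\<in>F. ?t j m) = c0_nth v j + (\<Sum>m\<in>F - {n}. ?t j m)"
          using sum.remove[OF F n, of "?t j"] by simp
        finally have "c0_nth ((inv B ^^ n) z - v) j =
            W (j + (- int n)) / W j * c0_nth u (j + (- int n)) + (\<Sum>m\<in>F - {n}. ?t j m)"
          by (simp add: minus_c0.rep_eq)
        moreover have "norm (\<Sum>m\<in>F - {n}. ?t j m) \<le> e / 4"
          unfolding L(2)[symmetric] using n diff F by (intro C(2) L(1)) auto
        moreover have "norm (W (j + (- int n)) / W j * c0_nth u (j + (- int n))) \<le> e / 4"
        proof -
          have "A / norm (W (int n)) \<le> A / K"
            using large n K A(1) by (intro divide_left_mono) auto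
          moreover have "norm (W (j + (- int n)) / W j * c0_nth u (j + (- int n))) \<le> A / norm (W (int n))"
            using A(2)[of j "- int n"] by simp
          ultimately show ?thesis using AK by linarith
        qed
        ultimately show "norm (c0_nth ((inv B ^^ n) z - v) j) \<le> e / 2"
          by (simp only:) (rule norm_triangle_le, linarith)
      qed
      with \<open>e > 0\<close> show "dist ((inv B ^^ n) z) v < e" by (simp add: dist_norm)
    qed
    with K show ?thesis by blast
  qed
  with L(1) show ?thesis by blast
qed

end

theorem theorem3:
  fixes w :: "int \<Rightarrow> 'a::{real_normed_field, euclidean_space}"
    and B :: "'a c0 \<Rightarrow> 'a c0"
  assumes "\<And>n. w n \<noteq> 0"
    and "is_weighted_backward_shift w B"
    and "invertible_c0_operator B"
    and "upper_frequently_hypercyclic B"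
  shows "upper_frequently_hypercyclic (inv B)"
proof -
  interpret invertible_shift w B using assms(1-3) by unfold_locales
  obtain D :: "'a c0 set" where D: "countable D" "closure D = UNIV" "D \<subseteq> c0_finite_support"
    using countable_dense_finite_support .
  show ?thesis
  proof (rule upper_frequently_hypercyclicI[OF _ D(1,2)])
    show "continuous_on UNIV (inv B)" using assms(3) by (simp add: invertible_c0_operator_def)
  next
    fix v and e :: real assume "v \<in> D" "0 < e"
    then have "v \<in> c0_finite_support" using D(3) by blast
    from inverse_orbit_approximation[OF this \<open>0 < e\<close>]
    obtain L where "L > 0" and L: "\<forall>u\<in>c0_finite_support. \<forall>\<eta>>0. \<exists>K>0. \<forall>F.
        finite F \<longrightarrow> large_products K L F \<longrightarrow>
        (\<exists>z. dist z u < \<eta> \<and> (\<forall>n\<in>F. dist ((inv B ^^ n) z) v < e))"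
      by blast
    from large_difference_sets[OF assms(4) \<open>L > 0\<close>]
    obtain \<delta> where "\<delta> > 0" and \<delta>: "\<forall>K>0. \<forall>N\<^sub>0. \<exists>N\<ge>N\<^sub>0. \<exists>F\<subseteq>{1..N}.
        \<delta> * real (N + 1) \<le> real (card F) \<and> large_products K L F"
      by blast
    have "\<exists>z. \<exists>N\<ge>N\<^sub>0. dist z u < \<eta> \<and>
        \<delta> * real (N + 1) \<le> real (card {n. n \<le> N \<and> dist ((inv B ^^ n) z) v < e})"
      if "u \<in> D" "\<eta> > 0" for u \<eta> N\<^sub>0
    proof -
      have "u \<in> c0_finite_support" using that(1) D(3) by blast
      with L that(2) obtain K where "K > 0" and K: "\<forall>F. finite F \<longrightarrow> large_products K L F \<longrightarrow>
        (\<exists>z. dist z u < \<eta> \<and> (\<forall>n\<in>F. dist ((inv B ^^ n) z) v < e))"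
        by meson
      obtain N F where N: "N \<ge> N\<^sub>0" and F: "F \<subseteq> {1..N}"
        "\<delta> * real (N + 1) \<le> real (card F)" "large_products K L F"
        using \<delta> \<open>K > 0\<close> by meson
      have "finite F" using F(1) finite_subset by blast
      with K F(3) obtain z where z: "dist z u < \<eta>" "\<forall>n\<in>F. dist ((inv B ^^ n) z) v < e"
        by meson
      have "card F \<le> card {n. n \<le> N \<and> dist ((inv B ^^ n) z) v < e}"
        using F(1) z(2) by (intro card_mono) auto
      with N z(1) F(2) show ?thesis by (intro exI[of _ z] exI[of _ N]) auto
    qed
    with \<open>\<delta> > 0\<close> show "\<exists>\<delta>>0. \<forall>u\<in>D. \<forall>\<eta>>0. \<forall>N\<^sub>0. \<exists>z. \<exists>N\<ge>N\<^sub>0. dist z u < \<eta> \<and>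
        \<delta> * real (N + 1) \<le> real (card {n. n \<le> N \<and> dist ((inv B ^^ n) z) v < e})"
      by blast
  qed
qed

end
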